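(* Let $\mathbb F$ be a field, $V=\mathbb F^4$ and $G=\mathbb Z_2^3$, and let $\sigma\colon G\times G\to\mathrm{Bil}(V\times V,V)$ be the twist $\sigma^{(4)}$ defined in the context. Then $V^{\tilde\sigma}[G]$ is a Lie algebra over $\mathbb Z_2^3$ (that is, the generalized group algebra $V^{\tilde\sigma}[G]$ is a Lie algebra) for every $\tilde\sigma\colon G\times G\to\mathrm{Bil}(V\times V,V)$ in the list $$\tilde\sigma\in\{\varepsilon^{T_i}\sigma,\ \eta^\lambda\sigma,\ \mu^\lambda\sigma,\ \beta^{\lambda_1,\lambda_2}\sigma:\ i=1,\dots,24;\ \lambda,\lambda_1,\lambda_2\in\mathbb F\setminus\{0\}\},$$ where $\varepsilon^{T_i},\eta^\lambda,\mu^\lambda,\beta^{\lambda_1,\lambda_2}\colon G\times G\to\mathbb F$ are the maps defined in the context. The same result is true when $V$ is replaced by $W=\mathbb F^3$, or by $S=\{(a_1,a_2,a_3)\in W:a_1+a_2+a_3=0\}$, and $\sigma$ is replaced by the twist $\sigma^{(3)}$ defined in the context (restricted to $S$ in the case of $S$).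
   Context: Generalized group algebra: for an abelian group $(G,+)$, an $\mathbb F$-vector space $V$ and a map (twist) $\sigma\colon G\times G\to\mathrm{Bil}(V\times V,V)$, $(g,h)\mapsto\sigma_{g,h}$ (with $\mathrm{Bil}(V\times V,V)$ the bilinear maps $V\times V\to V$), $V^\sigma[G]$ is the vector space of formal sums $\sum_{g\in G}r_g g$, $r_g\in V$, with product obtained by bilinear extension from $(rg)\cdot(sh)=\sigma_{g,h}(r,s)(g+h)$. If this product makes it a Lie algebra, it is called a Lie algebra over $G$. For $\varepsilon\colon G\times G\to\mathbb F$, $\varepsilon\sigma$ denotes the twist $(g,h)\mapsto\varepsilon(g,h)\sigma_{g,h}$. Labelling of $G=\mathbb Z_2^3$: $g_0=(0,0,0)$, $g_1=(1,0,0)$, $g_2=(0,1,0)$, $g_3=(0,0,1)$, $g_4=(1,1,0)$, $g_5=(0,1,1)$, $g_6=(1,1,1)$, $g_7=(1,0,1)$. With $I=\{1,\dots,7\}$, sums of indices such as $i+1$ (with $i\in I$) are taken modulo $7$ with values in $I$ (residue $0$ is represented by $7$; the index $0$ is distinct and denotes the neutral element). Twist $\sigma=\sigma^{(4)}$ on $V=\mathbb F^4$, with $\sigma_{i,j}:=\sigma(g_i,g_j)$, $r=(a_1,a_2,a_3,a_4)$, $s=(b_1,b_2,b_3,b_4)$, $i\in I$: $\sigma_{i,i+1}(r,s)=(-a_2b_1-a_3b_3,-a_2b_3-a_3b_1,a_1b_2+a_4b_4,a_1b_4+a_4b_2)$, $\sigma_{i,i+2}(r,s)=(a_2b_3+a_4b_4,-a_1b_1-a_3b_2,-a_1b_2-a_3b_1,a_2b_4+a_4b_3)$,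 $\sigma_{i,i+4}(r,s)=(-a_1b_2-a_2b_3,a_3b_1+a_4b_4,-a_1b_3-a_2b_2,a_3b_4+a_4b_1)$, $\sigma_{0,i}=\sigma_{i,0}=\sigma_{0,0}=\sigma_{i,i}=0$, and $\sigma_{i,i+3}(r,s)=-\sigma_{i,i+4}(s,r)$, $\sigma_{i,i+5}(r,s)=-\sigma_{i,i+2}(s,r)$, $\sigma_{i,i+6}(r,s)=-\sigma_{i,i+1}(s,r)$. Twist $\sigma=\sigma^{(3)}$ on $W=\mathbb F^3$, with $r=(a_1,a_2,a_3)$, $s=(b_1,b_2,b_3)$, $i\in I$: $\sigma_{i,i+1}(r,s)=(-a_2b_1-a_3b_3,-a_2b_3-a_3b_1,a_1b_2)$, $\sigma_{i,i+2}(r,s)=(a_2b_3,-a_1b_1-a_3b_2,-a_1b_2-a_3b_1)$, $\sigma_{i,i+4}(r,s)=(-a_1b_2-a_2b_3,a_3b_1,-a_1b_3-a_2b_2)$, $\sigma_{0,i}=\sigma_{i,0}=\sigma_{0,0}=\sigma_{i,i}=0$, and $\sigma_{i,i+3}(r,s)=-\sigma_{i,i+4}(s,r)$, $\sigma_{i,i+5}(r,s)=-\sigma_{i,i+2}(s,r)$, $\sigma_{i,i+6}(r,s)=-\sigma_{i,i+1}(s,r)$. It satisfies $\sigma_{g,h}(S,S)\subset S$ for all $g,h\in G$, so it restricts to a twist on $S$. Let $X=\{\{i,j\}:1\le i<j\le7\}$. All maps $\varepsilon\colon G\times G\to\mathbb F$ below are symmetric with $\varepsilon(g,g)=\varepsilon(g_0,g)=\varepsilon(g,g_0)=0$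 for all $g\in G$; we write $\varepsilon_{i,j}=\varepsilon(g_i,g_j)$, and they are thus determined by the values $\varepsilon_{i,j}$ with $\{i,j\}\in X$. For $T\subset X$: $\varepsilon^T_{i,j}=1$ if $\{i,j\}\in T$ and $\varepsilon^T_{i,j}=0$ otherwise. Writing $ij$ for $\{i,j\}$, the sets are $T_1=\emptyset$; $T_2=\{12\}$; $T_3=\{12,13\}$; $T_4=\{12,14\}$; $T_5=\{12,57\}$; $T_6=\{12,14,24\}$; $T_7=\{24,37,56\}$; $T_8=\{12,13,16\}$; $T_9=\{12,13,14\}$; $T_{10}=\{12,13,15\}$; $T_{11}=\{12,17,27\}$; $T_{12}=\{12,17,57\}$; $T_{13}=\{12,13,14,16\}$; $T_{14}=\{12,13,14,17\}$; $T_{15}=\{12,15,17,27\}$; $T_{16}=\{12,17,25,57\}$; $T_{17}=\{12,13,14,16,17\}$; $T_{18}=\{12,15,17,25,27\}$; $T_{19}=\{35,36,37,56,57,67\}$; $T_{20}=\{12,13,14,15,16,17\}$; $T_{21}=\{12,13,15,23,27,34\}$; $T_{22}=\{12,13,14,15,16,17,23,27,34,47\}$; $T_{23}=X\setminus T_{19}$; $T_{24}=X$. For $\lambda,\lambda_1,\lambda_2\in\mathbb F\setminus\{0\}$: $\eta^\lambda_{i,j}=0$ for $\{i,j\}\notin T_{14}$, $\eta^\lambda_{1,2}=\eta^\lambda_{1,3}=\eta^\lambda_{1,4}=1$, $\eta^\lambda_{1,7}=\lambda$; $\mu^\lambda_{i,j}=0$ for $\{i,j\}\notin T_{17}$, $\mu^\lambda_{1,2}=\mu^\lambda_{1,4}=\mu^\lambda_{1,6}=1$,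 $\mu^\lambda_{1,3}=\mu^\lambda_{1,7}=\lambda$; $\beta^{\lambda_1,\lambda_2}_{i,j}=0$ for $\{i,j\}\notin T_{20}$, $\beta^{\lambda_1,\lambda_2}_{1,2}=\beta^{\lambda_1,\lambda_2}_{1,4}=1$, $\beta^{\lambda_1,\lambda_2}_{1,3}=\beta^{\lambda_1,\lambda_2}_{1,7}=\lambda_1$, $\beta^{\lambda_1,\lambda_2}_{1,5}=\beta^{\lambda_1,\lambda_2}_{1,6}=\lambda_2$. *)

theory Defs
  imports "HOL-Analysis.Analysis" "HOL-Library.Poly_Mapping" "HOL-Library.Z2"
    "HOL-Library.Product_Plus"
begin

text \<open>A vector space is given by a type with a scalar multiplication satisfying
  \<^locale>\<open>vector_space\<close> together with a subspace of that type, which plays the role of the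
  carrier. A map counts as bilinear, and a bracket as a Lie bracket, if it is so on the carrier;
  values outside the carrier are irrelevant. So ``restricting'' a map to a subspace amounts
  to changing the carrier.\<close>

definition bilinear_on ::
  "('f::field \<Rightarrow> 'v::ab_group_add \<Rightarrow> 'v) \<Rightarrow> 'v set \<Rightarrow> ('v \<Rightarrow> 'v \<Rightarrow> 'v) \<Rightarrow> bool" where
  "bilinear_on smul V f \<longleftrightarrow>
     (\<forall>x\<in>V. \<forall>y\<in>V. f x y \<in> V) \<and>
     (\<forall>x\<in>V. \<forall>y\<in>V. \<forall>z\<in>V. f (x + y) z = f x z + f y z \<and> f x (y + z) = f x y + f x z) \<and>
     (\<forall>c. \<forall>x\<in>V. \<forall>y\<in>V. f (smul c x) y = smul c (f x y) \<and> f x (smul c y) = smul c (f x y))"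

locale lie_algebra = vector_space smul
  for smul :: "'f::field \<Rightarrow> 'l::ab_group_add \<Rightarrow> 'l" +
  fixes L :: "'l set" and bracket :: "'l \<Rightarrow> 'l \<Rightarrow> 'l"
  assumes subspace_carrier: "subspace L"
    and bilinear_bracket: "bilinear_on smul L bracket"
    and alternating: "x \<in> L \<Longrightarrow> bracket x x = 0"
    and jacobi: "\<lbrakk>x \<in> L; y \<in> L; z \<in> L\<rbrakk> \<Longrightarrow>
      bracket x (bracket y z) + bracket y (bracket z x) + bracket z (bracket x y) = 0"

definition is_twist ::
  "('f::field \<Rightarrow> 'v::ab_group_add \<Rightarrow> 'v) \<Rightarrow> 'v set \<Rightarrow> ('g \<Rightarrow> 'g \<Rightarrow> 'v \<Rightarrow> 'v \<Rightarrow> 'v) \<Rightarrow> bool" where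
  "is_twist smul V \<sigma> \<longleftrightarrow> (\<forall>g h. bilinear_on smul V (\<sigma> g h))"

text \<open>The formal sum of the \<open>r\<^sub>g g\<close> is the finitely supported function \<open>g \<mapsto> r\<^sub>g\<close>.\<close>

definition gga_carrier :: "'v set \<Rightarrow> ('g \<Rightarrow>\<^sub>0 'v::zero) set" where
  "gga_carrier V = {x. \<forall>g. Poly_Mapping.lookup x g \<in> V}"

definition gga_scale ::
  "('f \<Rightarrow> 'v \<Rightarrow> 'v) \<Rightarrow> 'f \<Rightarrow> ('g \<Rightarrow>\<^sub>0 'v::zero) \<Rightarrow> ('g \<Rightarrow>\<^sub>0 'v)" where
  "gga_scale smul c x = Poly_Mapping.map (smul c) x"

definition gga_mult ::
  "('g \<Rightarrow> 'g \<Rightarrow> 'v \<Rightarrow> 'v \<Rightarrow> 'v) \<Rightarrow>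
    ('g::ab_group_add \<Rightarrow>\<^sub>0 'v::ab_group_add) \<Rightarrow> ('g \<Rightarrow>\<^sub>0 'v) \<Rightarrow> ('g \<Rightarrow>\<^sub>0 'v)" where
  "gga_mult \<sigma> x y =
     (\<Sum>g\<in>Poly_Mapping.keys x. \<Sum>h\<in>Poly_Mapping.keys y.
        Poly_Mapping.single (g + h)
          (\<sigma> g h (Poly_Mapping.lookup x g) (Poly_Mapping.lookup y h)))"

text \<open>The group \<open>G\<close> is the whole type \<^typ>\<open>'g\<close>; \<open>V\<close> is a subspace of the type \<^typ>\<open>'v\<close>.\<close>

definition lie_algebra_over_group ::
  "('f::field \<Rightarrow> 'v::ab_group_add \<Rightarrow> 'v) \<Rightarrow> 'v set \<Rightarrow>
    ('g::ab_group_add \<Rightarrow> 'g \<Rightarrow> 'v \<Rightarrow> 'v \<Rightarrow> 'v) \<Rightarrow> bool" where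
  "lie_algebra_over_group smul V \<sigma> \<longleftrightarrow>
     vector_space smul \<and> module.subspace smul V \<and> is_twist smul V \<sigma> \<and>
     lie_algebra (gga_scale smul) (gga_carrier V) (gga_mult \<sigma>)"

definition scale_twist ::
  "('f \<Rightarrow> 'v \<Rightarrow> 'v) \<Rightarrow> ('g \<Rightarrow> 'g \<Rightarrow> 'f) \<Rightarrow> ('g \<Rightarrow> 'g \<Rightarrow> 'v \<Rightarrow> 'v \<Rightarrow> 'v) \<Rightarrow>
    'g \<Rightarrow> 'g \<Rightarrow> 'v \<Rightarrow> 'v \<Rightarrow> 'v" where
  "scale_twist smul \<epsilon> \<sigma> = (\<lambda>g h r s. smul (\<epsilon> g h) (\<sigma> g h r s))"

type_synonym Z2_3 = "bit \<times> bit \<times> bit"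

definition gl :: "nat \<Rightarrow> Z2_3" where
  "gl i = [(0,0,0), (1,0,0), (0,1,0), (0,0,1), (1,1,0), (0,1,1), (1,1,1), (1,0,1)] ! i"

definition idx :: "Z2_3 \<Rightarrow> nat" where
  "idx = the_inv_into {0..7} gl"

lemma inj_on_gl: "inj_on gl {0..7}"
proof -
  have "{0..7} = {0, 1, 2, 3, 4, 5, 6, 7::nat}"
    by auto
  then show ?thesis
    by (simp add: gl_def)
qed

lemma idx_gl: "i \<le> 7 \<Longrightarrow> idx (gl i) = i"
  unfolding idx_def by (rule the_inv_into_f_f[OF inj_on_gl]) simp

lemma bij_betw_gl: "bij_betw gl {0..7} UNIV"
proof -
  have fin: "finite (UNIV :: bit set)" and card: "card (UNIV :: bit set) = 2"
  proof -
    have U: "(UNIV :: bit set) = {0, 1}"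
      using bit_not_zero_iff by auto
    show "finite (UNIV :: bit set)" "card (UNIV :: bit set) = 2"
      unfolding U by simp_all
  qed
  have eq: "(UNIV :: Z2_3 set) = UNIV \<times> UNIV \<times> UNIV"
    by simp
  have "finite (UNIV :: Z2_3 set)" "card (UNIV :: Z2_3 set) = 8"
    unfolding eq by (simp_all only: finite_cartesian_product fin card_cartesian_product card)
  then have "gl ` {0..7} = UNIV"
    by (intro card_subset_eq) (simp_all add: card_image[OF inj_on_gl])
  then show ?thesis
    using inj_on_gl by (simp add: bij_betw_def)
qed

text \<open>\<open>cyc i k\<close> is the index \<open>i + k\<close> modulo 7, represented in \<open>{1..7}\<close>.\<close>

definition cyc :: "nat \<Rightarrow> nat \<Rightarrow> nat" where
  "cyc i k = (i + k - 1) mod 7 + 1"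

text \<open>The map \<open>\<sigma>\<^sub>i\<^sub>,\<^sub>j\<close> depends, for distinct \<open>i, j \<in> {1..7}\<close>, only on \<open>j - i\<close> modulo 7. The arguments
  \<open>p1, p2, p4\<close> are the values at \<open>(i, i+1)\<close>, \<open>(i, i+2)\<close>, \<open>(i, i+4)\<close>.\<close>

definition cyclic_twist ::
  "('v \<Rightarrow> 'v \<Rightarrow> 'v) \<Rightarrow> ('v \<Rightarrow> 'v \<Rightarrow> 'v) \<Rightarrow> ('v \<Rightarrow> 'v \<Rightarrow> 'v) \<Rightarrow>
    Z2_3 \<Rightarrow> Z2_3 \<Rightarrow> 'v \<Rightarrow> 'v \<Rightarrow> 'v::ab_group_add" where
  "cyclic_twist p1 p2 p4 g h r s =
     (let i = idx g; j = idx h in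
      if i = 0 \<or> j = 0 \<or> i = j then 0
      else if j = cyc i 1 then p1 r s
      else if j = cyc i 2 then p2 r s
      else if j = cyc i 4 then p4 r s
      else if j = cyc i 3 then - p4 s r
      else if j = cyc i 5 then - p2 s r
      else - p1 s r)"

definition sigma4 :: "Z2_3 \<Rightarrow> Z2_3 \<Rightarrow> 'f::field ^ 4 \<Rightarrow> 'f ^ 4 \<Rightarrow> 'f ^ 4" where
  "sigma4 = cyclic_twist
     (\<lambda>a b. vector [- a$2 * b$1 - a$3 * b$3, - a$2 * b$3 - a$3 * b$1,
                    a$1 * b$2 + a$4 * b$4, a$1 * b$4 + a$4 * b$2])
     (\<lambda>a b. vector [a$2 * b$3 + a$4 * b$4, - a$1 * b$1 - a$3 * b$2,
                    - a$1 * b$2 - a$3 * b$1, a$2 * b$4 + a$4 * b$3])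
     (\<lambda>a b. vector [- a$1 * b$2 - a$2 * b$3, a$3 * b$1 + a$4 * b$4,
                    - a$1 * b$3 - a$2 * b$2, a$3 * b$4 + a$4 * b$1])"

definition sigma3 :: "Z2_3 \<Rightarrow> Z2_3 \<Rightarrow> 'f::field ^ 3 \<Rightarrow> 'f ^ 3 \<Rightarrow> 'f ^ 3" where
  "sigma3 = cyclic_twist
     (\<lambda>a b. vector [- a$2 * b$1 - a$3 * b$3, - a$2 * b$3 - a$3 * b$1, a$1 * b$2])
     (\<lambda>a b. vector [a$2 * b$3, - a$1 * b$1 - a$3 * b$2, - a$1 * b$2 - a$3 * b$1])
     (\<lambda>a b. vector [- a$1 * b$2 - a$2 * b$3, a$3 * b$1, - a$1 * b$3 - a$2 * b$2])"

definition S_subspace :: "('f::field ^ 3) set" where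
  "S_subspace = {a. a$1 + a$2 + a$3 = 0}"

text \<open>The symmetric map on \<open>G \<times> G\<close> that vanishes on the diagonal and whenever an argument is the
  neutral element, and takes the value \<open>c {i, j}\<close> at \<open>(g\<^sub>i, g\<^sub>j)\<close> for distinct \<open>i, j \<in> {1..7}\<close>.\<close>

definition sym_map :: "(nat set \<Rightarrow> 'f::zero) \<Rightarrow> Z2_3 \<Rightarrow> Z2_3 \<Rightarrow> 'f" where
  "sym_map c g h = (if g = h \<or> g = gl 0 \<or> h = gl 0 then 0 else c {idx g, idx h})"

definition pairs_X :: "nat set set" where
  "pairs_X = {{i, j} | i j. 1 \<le> i \<and> i < j \<and> j \<le> 7}"

definition T19 :: "nat set set" where
  "T19 = {{3,5}, {3,6}, {3,7}, {5,6}, {5,7}, {6,7}}"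

text \<open>\<open>T_set k\<close> is meant for \<open>1 \<le> k \<le> 24\<close>; list positions start at 0.\<close>

definition T_set :: "nat \<Rightarrow> nat set set" where
  "T_set k =
    [{},
     {{1,2}},
     {{1,2}, {1,3}},
     {{1,2}, {1,4}},
     {{1,2}, {5,7}},
     {{1,2}, {1,4}, {2,4}},
     {{2,4}, {3,7}, {5,6}},
     {{1,2}, {1,3}, {1,6}},
     {{1,2}, {1,3}, {1,4}},
     {{1,2}, {1,3}, {1,5}},
     {{1,2}, {1,7}, {2,7}},
     {{1,2}, {1,7}, {5,7}},
     {{1,2}, {1,3}, {1,4}, {1,6}},
     {{1,2}, {1,3}, {1,4}, {1,7}},
     {{1,2}, {1,5}, {1,7}, {2,7}},
     {{1,2}, {1,7}, {2,5}, {5,7}},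
     {{1,2}, {1,3}, {1,4}, {1,6}, {1,7}},
     {{1,2}, {1,5}, {1,7}, {2,5}, {2,7}},
     T19,
     {{1,2}, {1,3}, {1,4}, {1,5}, {1,6}, {1,7}},
     {{1,2}, {1,3}, {1,5}, {2,3}, {2,7}, {3,4}},
     {{1,2}, {1,3}, {1,4}, {1,5}, {1,6}, {1,7}, {2,3}, {2,7}, {3,4}, {4,7}},
     pairs_X - T19,
     pairs_X] ! (k - 1)"

definition eps :: "nat set set \<Rightarrow> Z2_3 \<Rightarrow> Z2_3 \<Rightarrow> 'f::field" where
  "eps A = sym_map (\<lambda>p. if p \<in> A then 1 else 0)"

definition eta :: "'f::field \<Rightarrow> Z2_3 \<Rightarrow> Z2_3 \<Rightarrow> 'f" where
  "eta l = sym_map (\<lambda>p. if p \<in> {{1,2}, {1,3}, {1,4}} then 1 else if p = {1,7} then l else 0)"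

definition mu :: "'f::field \<Rightarrow> Z2_3 \<Rightarrow> Z2_3 \<Rightarrow> 'f" where
  "mu l = sym_map (\<lambda>p. if p \<in> {{1,2}, {1,4}, {1,6}} then 1
                       else if p \<in> {{1,3}, {1,7}} then l else 0)"

definition beta :: "'f::field \<Rightarrow> 'f \<Rightarrow> Z2_3 \<Rightarrow> Z2_3 \<Rightarrow> 'f" where
  "beta l1 l2 = sym_map (\<lambda>p. if p \<in> {{1,2}, {1,4}} then 1
                             else if p \<in> {{1,3}, {1,7}} then l1
                             else if p \<in> {{1,5}, {1,6}} then l2 else 0)"

definition twist_list ::
  "('f::field \<Rightarrow> 'v \<Rightarrow> 'v) \<Rightarrow> (Z2_3 \<Rightarrow> Z2_3 \<Rightarrow> 'v \<Rightarrow> 'v \<Rightarrow> 'v) \<Rightarrow>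
    (Z2_3 \<Rightarrow> Z2_3 \<Rightarrow> 'v \<Rightarrow> 'v \<Rightarrow> 'v) set" where
  "twist_list smul \<sigma> =
     {scale_twist smul (eps (T_set i)) \<sigma> | i. i \<in> {1..24}} \<union>
     {scale_twist smul (eta l) \<sigma> | l. l \<noteq> 0} \<union>
     {scale_twist smul (mu l) \<sigma> | l. l \<noteq> 0} \<union>
     {scale_twist smul (beta l1 l2) \<sigma> | l1 l2. l1 \<noteq> 0 \<and> l2 \<noteq> 0}"

end

theory Submission
  imports Defs
begin

text \<open>A twist gives a Lie algebra as soon as it is alternating and satisfies the Jacobi identity on
  homogeneous elements. For the given twists the automorphism \<open>g\<^sub>i \<mapsto> g\<^sub>i\<^sub>+\<^sub>1\<close> of \<open>G\<close> reduces the
  Jacobi identity to triples containing \<open>g\<^sub>1\<close>, where it amounts to ten identities between the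
  bilinear maps \<open>\<sigma>\<^sub>i\<^sub>,\<^sub>i\<^sub>+\<^sub>1\<close>, \<open>\<sigma>\<^sub>i\<^sub>,\<^sub>i\<^sub>+\<^sub>2\<close>, \<open>\<sigma>\<^sub>i\<^sub>,\<^sub>i\<^sub>+\<^sub>4\<close>. Passing from \<open>\<sigma>\<close> to \<open>\<epsilon>\<sigma>\<close> multiplies the
  three terms of the Jacobi identity by \<open>\<epsilon>(g,h+k)\<epsilon>(h,k)\<close> and its cyclic permutations, which agree: for
  the sets \<open>T\<^sub>i\<close> by inspection, and for \<open>\<eta>, \<mu>, \<beta>\<close> because they are supported on pairs containing
  \<open>g\<^sub>1\<close>, so that all three products vanish for distinct \<open>g, h, k\<close>.\<close>

text \<open>The terms at \<open>(a, b)\<close> and \<open>(b, a)\<close> cancel. Vanishing on the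
  diagonal is a separate assumption, because antisymmetry only gives
  \<open>f a a + f a a = 0\<close>, which says nothing in characteristic 2.\<close>

lemma sum_antisymmetric_eq_0:
  fixes f :: "'a \<Rightarrow> 'a \<Rightarrow> 'b::ab_group_add"
  assumes "finite A" and "\<And>a. f a a = 0" and "\<And>a b. f a b = - f b a"
  shows "(\<Sum>a\<in>A. \<Sum>b\<in>A. f a b) = 0"
  using assms(1)
proof induction
  case (insert x A)
  have "(\<Sum>a\<in>A. f a x) = - (\<Sum>a\<in>A. f x a)"
    unfolding sum_negf[symmetric] by (rule sum.cong) (auto intro: assms(3))
  with insert show ?case
    by (simp add: sum.distrib assms(2))
qed simp

lemma sum_rotate:
  "(\<Sum>a\<in>A. \<Sum>b\<in>B. \<Sum>c\<in>C. f a b c) = (\<Sum>c\<in>C. \<Sum>a\<in>A. \<Sum>b\<in>B. f a b c)"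
  by (rule trans[OF sum.cong[OF refl sum.swap] sum.swap])

section \<open>The generalized group algebra of a twist\<close>

locale twist_on_subspace = vector_space smul
  for smul :: "'f::field \<Rightarrow> 'v::ab_group_add \<Rightarrow> 'v" +
  fixes V :: "'v set" and \<sigma> :: "'g::ab_group_add \<Rightarrow> 'g \<Rightarrow> 'v \<Rightarrow> 'v \<Rightarrow> 'v"
  assumes subspace_V: "subspace V" and twist: "is_twist smul V \<sigma>"
begin

lemma twist_closed: "r \<in> V \<Longrightarrow> s \<in> V \<Longrightarrow> \<sigma> g h r s \<in> V"
  using twist by (simp add: is_twist_def bilinear_on_def)

lemma twist_add:
  assumes "r \<in> V" "s \<in> V" "t \<in> V"
  shows "\<sigma> g h (r + s) t = \<sigma> g h r t + \<sigma> g h s t" "\<sigma> g h r (s + t) = \<sigma> g h r s + \<sigma> g h r t"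
  using twist assms by (simp_all add: is_twist_def bilinear_on_def)

lemma twist_smul:
  assumes "r \<in> V" "s \<in> V"
  shows "\<sigma> g h (smul c r) s = smul c (\<sigma> g h r s)" "\<sigma> g h r (smul c s) = smul c (\<sigma> g h r s)"
  using twist assms by (simp_all add: is_twist_def bilinear_on_def)

lemma zero_mem: "0 \<in> V"
  using subspace_V subspace_0 by blast

lemma twist_zero:
  assumes "r \<in> V"
  shows "\<sigma> g h 0 r = 0" "\<sigma> g h r 0 = 0"
  using twist_add[OF zero_mem zero_mem assms] twist_add[OF assms zero_mem zero_mem]
  by simp_all

text \<open>\<open>Poly_Mapping.map\<close> applies the function only on the support; off the
  support this agrees with scaling since \<open>smul c 0 = 0\<close>.\<close>

lemma lookup_gga_scale:
  "Poly_Mapping.lookup (gga_scale smul c x) g = smul c (Poly_Mapping.lookup x g)"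
  by (simp add: gga_scale_def map.rep_eq when_def)

lemma vector_space_gga: "vector_space (gga_scale smul)"
  by unfold_locales
    (auto intro!: poly_mapping_eqI
      simp: lookup_gga_scale lookup_add scale_right_distrib scale_left_distrib)

lemma subspace_gga: "module.subspace (gga_scale smul) (gga_carrier V)"
proof -
  interpret gga: vector_space "gga_scale smul"
    by (rule vector_space_gga)
  show ?thesis
    using subspace_V unfolding gga.subspace_def subspace_def
    by (simp add: gga_carrier_def lookup_add lookup_gga_scale)
qed

lemma single_mem: "v \<in> V \<Longrightarrow> Poly_Mapping.single g v \<in> gga_carrier V"
  by (auto simp: gga_carrier_def lookup_single when_def zero_mem)

lemma sum_mem:
  assumes "\<And>i. i \<in> I \<Longrightarrow> f i \<in> gga_carrier V"
  shows "(\<Sum>i\<in>I. f i) \<in> gga_carrier V"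
proof -
  interpret gga: vector_space "gga_scale smul"
    by (rule vector_space_gga)
  show ?thesis
    using assms by (rule gga.subspace_sum[OF subspace_gga])
qed

lemma gga_mult_mem:
  assumes "x \<in> gga_carrier V" "y \<in> gga_carrier V"
  shows "gga_mult \<sigma> x y \<in> gga_carrier V"
  using assms unfolding gga_mult_def
  by (intro sum_mem single_mem twist_closed) (auto simp: gga_carrier_def)

text \<open>Terms outside the supports vanish because a bilinear map is zero when one argument is.
  This allows products of elements with different supports to be compared over common index
  sets.\<close>

lemma gga_mult_superset:
  assumes "x \<in> gga_carrier V" "y \<in> gga_carrier V"
    and "finite A" "finite B" "Poly_Mapping.keys x \<subseteq> A" "Poly_Mapping.keys y \<subseteq> B"
  shows "gga_mult \<sigma> x y =
    (\<Sum>g\<in>A. \<Sum>h\<in>B. Poly_Mapping.single (g + h)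
       (\<sigma> g h (Poly_Mapping.lookup x g) (Poly_Mapping.lookup y h)))"
proof -
  have "Poly_Mapping.lookup x g \<in> V" "Poly_Mapping.lookup y g \<in> V" for g
    using assms(1,2) by (auto simp: gga_carrier_def)
  then have "gga_mult \<sigma> x y = (\<Sum>g\<in>Poly_Mapping.keys x. \<Sum>h\<in>B. Poly_Mapping.single (g + h)
       (\<sigma> g h (Poly_Mapping.lookup x g) (Poly_Mapping.lookup y h)))"
    unfolding gga_mult_def using assms
    by (intro sum.cong[OF refl] sum.mono_neutral_left) (auto simp: in_keys_iff twist_zero)
  also have "\<dots> = (\<Sum>g\<in>A. \<Sum>h\<in>B. Poly_Mapping.single (g + h)
       (\<sigma> g h (Poly_Mapping.lookup x g) (Poly_Mapping.lookup y h)))"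
    using assms \<open>\<And>g. Poly_Mapping.lookup y g \<in> V\<close>
    by (intro sum.mono_neutral_left) (auto simp: in_keys_iff twist_zero)
  finally show ?thesis .
qed

lemma gga_mult_add:
  assumes "x \<in> gga_carrier V" "y \<in> gga_carrier V" "z \<in> gga_carrier V"
  shows "gga_mult \<sigma> (x + y) z = gga_mult \<sigma> x z + gga_mult \<sigma> y z"
    and "gga_mult \<sigma> x (y + z) = gga_mult \<sigma> x y + gga_mult \<sigma> x z"
proof -
  interpret gga: vector_space "gga_scale smul"
    by (rule vector_space_gga)
  let ?A = "Poly_Mapping.keys x \<union> Poly_Mapping.keys y \<union> Poly_Mapping.keys z"
  have mem: "Poly_Mapping.lookup x g \<in> V" "Poly_Mapping.lookup y g \<in> V"
    "Poly_Mapping.lookup z g \<in> V" for g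
    using assms by (auto simp: gga_carrier_def)
  have sums: "x + y \<in> gga_carrier V" "y + z \<in> gga_carrier V"
    using assms gga.subspace_add[OF subspace_gga] by auto
  have keys: "Poly_Mapping.keys (x + y) \<subseteq> ?A" "Poly_Mapping.keys (y + z) \<subseteq> ?A"
    using Poly_Mapping.keys_add[of x y] Poly_Mapping.keys_add[of y z] by auto
  show "gga_mult \<sigma> (x + y) z = gga_mult \<sigma> x z + gga_mult \<sigma> y z"
    by (subst (1 2 3) gga_mult_superset[where A = ?A and B = ?A])
      (use assms sums keys in \<open>auto simp: lookup_add twist_add mem single_add sum.distrib\<close>)
  show "gga_mult \<sigma> x (y + z) = gga_mult \<sigma> x y + gga_mult \<sigma> x z"
    by (subst (1 2 3) gga_mult_superset[where A = ?A and B = ?A])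
      (use assms sums keys in \<open>auto simp: lookup_add twist_add mem single_add sum.distrib\<close>)
qed

lemma gga_scale_sum:
  "gga_scale smul c (\<Sum>i\<in>I. f i) = (\<Sum>i\<in>I. gga_scale smul c (f i))"
proof -
  interpret gga: vector_space "gga_scale smul"
    by (rule vector_space_gga)
  show ?thesis
    by (rule gga.scale_sum_right)
qed

lemma gga_scale_single:
  "gga_scale smul c (Poly_Mapping.single g v) = Poly_Mapping.single g (smul c v)"
  by (rule poly_mapping_eqI) (simp add: lookup_gga_scale lookup_single when_def)

lemma gga_mult_smul:
  assumes "x \<in> gga_carrier V" "y \<in> gga_carrier V"
  shows "gga_mult \<sigma> (gga_scale smul c x) y = gga_scale smul c (gga_mult \<sigma> x y)"
    and "gga_mult \<sigma> x (gga_scale smul c y) = gga_scale smul c (gga_mult \<sigma> x y)"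
proof -
  interpret gga: vector_space "gga_scale smul"
    by (rule vector_space_gga)
  have mem: "Poly_Mapping.lookup x g \<in> V" "Poly_Mapping.lookup y g \<in> V" for g
    using assms by (auto simp: gga_carrier_def)
  have scaled: "gga_scale smul c x \<in> gga_carrier V" "gga_scale smul c y \<in> gga_carrier V"
    using assms gga.subspace_scale[OF subspace_gga] by auto
  have keys: "Poly_Mapping.keys (gga_scale smul c x) \<subseteq> Poly_Mapping.keys x"
    "Poly_Mapping.keys (gga_scale smul c y) \<subseteq> Poly_Mapping.keys y"
    by (auto simp: in_keys_iff lookup_gga_scale)
  show "gga_mult \<sigma> (gga_scale smul c x) y = gga_scale smul c (gga_mult \<sigma> x y)"
    by (subst (1 2) gga_mult_superset[where A = "Poly_Mapping.keys x" and B = "Poly_Mapping.keys y"])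
      (use assms scaled keys in
        \<open>auto simp: gga_scale_sum gga_scale_single lookup_gga_scale twist_smul mem\<close>)
  show "gga_mult \<sigma> x (gga_scale smul c y) = gga_scale smul c (gga_mult \<sigma> x y)"
    by (subst (1 2) gga_mult_superset[where A = "Poly_Mapping.keys x" and B = "Poly_Mapping.keys y"])
      (use assms scaled keys in
        \<open>auto simp: gga_scale_sum gga_scale_single lookup_gga_scale twist_smul mem\<close>)
qed

lemma gga_mult_sum_right:
  assumes "x \<in> gga_carrier V" "\<And>i. i \<in> I \<Longrightarrow> f i \<in> gga_carrier V"
  shows "gga_mult \<sigma> x (\<Sum>i\<in>I. f i) = (\<Sum>i\<in>I. gga_mult \<sigma> x (f i))"
  using assms(2)
proof (induction I rule: infinite_finite_induct)
  case (insert i I)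
  then show ?case
    using assms(1) by (simp add: gga_mult_add sum_mem)
qed (simp_all add: gga_mult_def)

lemma gga_mult_single_right:
  assumes "x \<in> gga_carrier V" "v \<in> V"
  shows "gga_mult \<sigma> x (Poly_Mapping.single h v) =
    (\<Sum>g\<in>Poly_Mapping.keys x. Poly_Mapping.single (g + h) (\<sigma> g h (Poly_Mapping.lookup x g) v))"
  using assms by (subst gga_mult_superset[where A = "Poly_Mapping.keys x" and B = "{h}"])
    (auto simp: single_mem)

lemma gga_mult_mult:
  assumes "x \<in> gga_carrier V" "y \<in> gga_carrier V" "z \<in> gga_carrier V"
  shows "gga_mult \<sigma> x (gga_mult \<sigma> y z) =
    (\<Sum>g\<in>Poly_Mapping.keys x. \<Sum>h\<in>Poly_Mapping.keys y. \<Sum>k\<in>Poly_Mapping.keys z.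
       Poly_Mapping.single (g + (h + k)) (\<sigma> g (h + k) (Poly_Mapping.lookup x g)
         (\<sigma> h k (Poly_Mapping.lookup y h) (Poly_Mapping.lookup z k))))"
proof -
  have mem: "Poly_Mapping.lookup y g \<in> V" "Poly_Mapping.lookup z g \<in> V" for g
    using assms by (auto simp: gga_carrier_def)
  have "gga_mult \<sigma> x (gga_mult \<sigma> y z) =
    (\<Sum>h\<in>Poly_Mapping.keys y. \<Sum>k\<in>Poly_Mapping.keys z. \<Sum>g\<in>Poly_Mapping.keys x.
       Poly_Mapping.single (g + (h + k)) (\<sigma> g (h + k) (Poly_Mapping.lookup x g)
         (\<sigma> h k (Poly_Mapping.lookup y h) (Poly_Mapping.lookup z k))))"
    unfolding gga_mult_def[of \<sigma> y z] using assms
    by (simp add: gga_mult_sum_right gga_mult_single_right sum_mem single_mem twist_closed mem)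
  \<comment> \<open>The sum over the support of \<open>x\<close> moves outwards in two stages: past
    \<open>k\<close> here, past \<open>h\<close> in the last step.\<close>
  also have "\<dots> = (\<Sum>h\<in>Poly_Mapping.keys y. \<Sum>g\<in>Poly_Mapping.keys x. \<Sum>k\<in>Poly_Mapping.keys z.
       Poly_Mapping.single (g + (h + k)) (\<sigma> g (h + k) (Poly_Mapping.lookup x g)
         (\<sigma> h k (Poly_Mapping.lookup y h) (Poly_Mapping.lookup z k))))"
    by (rule sum.cong[OF refl], rule sum.swap)
  finally show ?thesis
    by (simp only: sum.swap[of _ "Poly_Mapping.keys x"])
qed

lemma lie_algebra_over_groupI:
  assumes alternating: "\<And>g r. r \<in> V \<Longrightarrow> \<sigma> g g r r = 0"
    and antisymmetric: "\<And>g h r s. \<lbrakk>r \<in> V; s \<in> V\<rbrakk> \<Longrightarrow> \<sigma> g h r s = - \<sigma> h g s r"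
    and jacobi: "\<And>g h k r s t. \<lbrakk>r \<in> V; s \<in> V; t \<in> V\<rbrakk> \<Longrightarrow>
      \<sigma> g (h + k) r (\<sigma> h k s t) + \<sigma> h (k + g) s (\<sigma> k g t r) + \<sigma> k (g + h) t (\<sigma> g h r s) = 0"
  shows "lie_algebra_over_group smul V \<sigma>"
proof -
  interpret gga: vector_space "gga_scale smul"
    by (rule vector_space_gga)
  have "lie_algebra (gga_scale smul) (gga_carrier V) (gga_mult \<sigma>)"
  proof
    show "gga.subspace (gga_carrier V)"
      by (rule subspace_gga)
    show "bilinear_on (gga_scale smul) (gga_carrier V) (gga_mult \<sigma>)"
      by (simp add: bilinear_on_def gga_mult_mem gga_mult_add gga_mult_smul)
    fix x y z :: "'g \<Rightarrow>\<^sub>0 'v"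
    assume x: "x \<in> gga_carrier V"
    then have x': "Poly_Mapping.lookup x g \<in> V" for g
      by (simp add: gga_carrier_def)
    show "gga_mult \<sigma> x x = 0"
      unfolding gga_mult_def
    proof (rule sum_antisymmetric_eq_0)
      show "Poly_Mapping.single (g + h) (\<sigma> g h (Poly_Mapping.lookup x g) (Poly_Mapping.lookup x h)) =
        - Poly_Mapping.single (h + g) (\<sigma> h g (Poly_Mapping.lookup x h) (Poly_Mapping.lookup x g))"
        for g h
        by (subst antisymmetric) (simp_all add: x' add.commute single_uminus)
    qed (simp_all add: alternating x')
    assume y: "y \<in> gga_carrier V" and z: "z \<in> gga_carrier V"
    then have y': "Poly_Mapping.lookup y g \<in> V" and z': "Poly_Mapping.lookup z g \<in> V" for g
      by (simp_all add: gga_carrier_def)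
    let ?X = "Poly_Mapping.keys x" and ?Y = "Poly_Mapping.keys y" and ?Z = "Poly_Mapping.keys z"
    \<comment> \<open>The other two triple sums are brought to the same index order. As the group is
      abelian, all three then have degree \<open>g + (h + k)\<close>, and the Jacobi identity can be
      applied termwise.\<close>
    have yzx: "gga_mult \<sigma> y (gga_mult \<sigma> z x) = (\<Sum>g\<in>?X. \<Sum>h\<in>?Y. \<Sum>k\<in>?Z.
       Poly_Mapping.single (g + (h + k)) (\<sigma> h (k + g) (Poly_Mapping.lookup y h)
         (\<sigma> k g (Poly_Mapping.lookup z k) (Poly_Mapping.lookup x g))))"
      unfolding gga_mult_mult[OF y z x]
      by (subst sum_rotate) (simp add: ac_simps)
    have zxy: "gga_mult \<sigma> z (gga_mult \<sigma> x y) = (\<Sum>g\<in>?X. \<Sum>h\<in>?Y. \<Sum>k\<in>?Z.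
       Poly_Mapping.single (g + (h + k)) (\<sigma> k (g + h) (Poly_Mapping.lookup z k)
         (\<sigma> g h (Poly_Mapping.lookup x g) (Poly_Mapping.lookup y h))))"
      unfolding gga_mult_mult[OF z x y]
      by (subst sum_rotate[symmetric]) (simp add: ac_simps)
    show "gga_mult \<sigma> x (gga_mult \<sigma> y z) + gga_mult \<sigma> y (gga_mult \<sigma> z x) +
        gga_mult \<sigma> z (gga_mult \<sigma> x y) = 0"
      unfolding gga_mult_mult[OF x y z] yzx zxy
      by (simp add: jacobi x' y' z' flip: sum.distrib single_add)
  qed
  then show ?thesis
    unfolding lie_algebra_over_group_def
    using vector_space_axioms subspace_V twist by blast
qed

end

section \<open>Multiplying a twist by a scalar map\<close>

locale alternating_jacobi_twist = twist_on_subspace +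
  assumes diagonal: "\<lbrakk>r \<in> V; s \<in> V\<rbrakk> \<Longrightarrow> \<sigma> g g r s = 0"
    and antisymmetric: "\<lbrakk>r \<in> V; s \<in> V\<rbrakk> \<Longrightarrow> \<sigma> g h r s = - \<sigma> h g s r"
    and jacobi: "\<lbrakk>r \<in> V; s \<in> V; t \<in> V\<rbrakk> \<Longrightarrow>
      \<sigma> g (h + k) r (\<sigma> h k s t) + \<sigma> h (k + g) s (\<sigma> k g t r) + \<sigma> k (g + h) t (\<sigma> g h r s) = 0"
begin

text \<open>For pairwise distinct \<open>g\<close>, \<open>h\<close>, \<open>k\<close> the three
  Jacobi terms acquire one common weight, so the new Jacobi sum is a multiple of the old one.
  Triples with a repetition are not covered by \<open>cyclic\<close>; there \<open>diagonal\<close>,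
  the vanishing of \<open>\<sigma> g g\<close> on all arguments, removes the one term whose weight
  may differ.\<close>

lemma lie_algebra_over_group_scale_twist:
  assumes sym: "\<And>g h. \<epsilon> g h = \<epsilon> h g"
    and cyclic: "\<And>g h k. \<lbrakk>g \<noteq> h; h \<noteq> k; k \<noteq> g\<rbrakk> \<Longrightarrow>
      \<epsilon> g (h + k) * \<epsilon> h k = \<epsilon> h (k + g) * \<epsilon> k g"
  shows "lie_algebra_over_group smul V (scale_twist smul \<epsilon> \<sigma>)"
proof -
  have V: "smul c r \<in> V" if "r \<in> V" for c r
    using that subspace_V subspace_scale by blast
  interpret scaled: twist_on_subspace smul V "scale_twist smul \<epsilon> \<sigma>"
    by unfold_locales
      (auto simp: subspace_V is_twist_def bilinear_on_def scale_twist_def V twist_closed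
        twist_add twist_smul scale_right_distrib scale_left_commute)
  let ?w = "\<lambda>g h k. \<epsilon> g (h + k) * \<epsilon> h k"
  let ?J = "\<lambda>g h k r s t. smul (?w g h k) (\<sigma> g (h + k) r (\<sigma> h k s t)) +
    smul (?w h k g) (\<sigma> h (k + g) s (\<sigma> k g t r)) + smul (?w k g h) (\<sigma> k (g + h) t (\<sigma> g h r s))"
  have uniform: "?J g h k r s t = 0"
    if "r \<in> V" "s \<in> V" "t \<in> V" "?w g h k = ?w h k g" "?w k g h = ?w h k g" for g h k r s t
    using jacobi[OF that(1-3), of g h k] that(4,5) by (simp flip: scale_right_distrib)
  text \<open>For \<open>g = h\<close> the first two terms have the same weight, and the third one vanishes.\<close>
  have eq: "?J g g k r s t = 0" if "r \<in> V" "s \<in> V" "t \<in> V" for g k r s t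
  proof -
    have "?w g g k = ?w g k g"
      by (simp add: sym add.commute)
    moreover have "\<sigma> k (g + g) t (\<sigma> g g r s) = 0"
      using that by (simp add: diagonal twist_zero)
    ultimately show ?thesis
      using jacobi[OF that, of g g k] by (simp flip: scale_right_distrib)
  qed
  have J: "?J g h k r s t = 0" if "r \<in> V" "s \<in> V" "t \<in> V" for g h k r s t
  proof -
    consider "g = h" | "h = k" | "k = g" | "g \<noteq> h" "h \<noteq> k" "k \<noteq> g"
      by blast
    then show ?thesis
    proof cases
      case 1
      then show ?thesis
        using eq that by blast
    next
      \<comment> \<open>The Jacobi sum is unchanged by rotating the triple, so the remaining
        coincidences reduce to the first.\<close>
      case 2
      then show ?thesis
        using eq[OF that(2,3,1), of h g] by (simp add: ac_simps)
    next
      case 3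
      then show ?thesis
        using eq[OF that(3,1,2), of g h] by (simp add: ac_simps)
    next
      case 4
      then show ?thesis
        using uniform that cyclic by metis
    qed
  qed
  show ?thesis
  proof (rule scaled.lie_algebra_over_groupI)
    fix g h k r s t
    assume r: "r \<in> V" and s: "s \<in> V"
    show "scale_twist smul \<epsilon> \<sigma> g g r r = 0"
      using r by (simp add: scale_twist_def diagonal)
    show "scale_twist smul \<epsilon> \<sigma> g h r s = - scale_twist smul \<epsilon> \<sigma> h g s r"
      using antisymmetric[OF r s, of g h] by (simp add: scale_twist_def sym[of g h])
    assume t: "t \<in> V"
    show "scale_twist smul \<epsilon> \<sigma> g (h + k) r (scale_twist smul \<epsilon> \<sigma> h k s t) +
        scale_twist smul \<epsilon> \<sigma> h (k + g) s (scale_twist smul \<epsilon> \<sigma> k g t r) +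
        scale_twist smul \<epsilon> \<sigma> k (g + h) t (scale_twist smul \<epsilon> \<sigma> g h r s) = 0"
      using J[OF r s t, of g h k] r s t by (simp add: scale_twist_def twist_smul twist_closed)
  qed
qed

end

section \<open>Cyclic twists on the group of order 8\<close>

lemma idx_simps:
  "idx (0,0,0) = 0" "idx (1,0,0) = 1" "idx (0,1,0) = 2" "idx (0,0,1) = 3"
  "idx (1,1,0) = 4" "idx (0,1,1) = 5" "idx (1,1,1) = 6" "idx (1,0,1) = 7"
  using idx_gl[of 0] idx_gl[of 1] idx_gl[of 2] idx_gl[of 3] idx_gl[of 4] idx_gl[of 5]
    idx_gl[of 6] idx_gl[of 7]
  by (simp_all add: gl_def)

text \<open>Reduces statements about all group elements to evaluations of \<open>idx\<close> and
  \<open>cyc\<close> at the eight elements, listed in the order of their labels.\<close>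

lemma forall_Z2_3:
  "(\<forall>g::Z2_3. P g) \<longleftrightarrow> P (0,0,0) \<and> P (1,0,0) \<and> P (0,1,0) \<and> P (0,0,1) \<and>
     P (1,1,0) \<and> P (0,1,1) \<and> P (1,1,1) \<and> P (1,0,1)"
proof -
  have "(\<forall>b::bit. Q b) \<longleftrightarrow> Q 0 \<and> Q 1" for Q
    by (metis (full_types) bit_not_zero_iff)
  then show ?thesis
    unfolding split_paired_All by auto
qed

lemma is_twist_cyclic_twist:
  assumes "module.subspace smul V" "vector_space smul"
    and "bilinear_on smul V p1" "bilinear_on smul V p2" "bilinear_on smul V p4"
  shows "is_twist smul V (cyclic_twist p1 p2 p4)"
proof -
  interpret vector_space smul by fact
  have zero: "bilinear_on smul V (\<lambda>r s. 0)"
    using assms(1) by (simp add: bilinear_on_def subspace_0)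
  have swap: "bilinear_on smul V (\<lambda>r s. - p s r)" if "bilinear_on smul V p" for p
    using assms(1) that by (auto simp: bilinear_on_def subspace_neg)
  \<comment> \<open>The case distinction does not depend on \<open>r\<close> and \<open>s\<close>,
    so it can be made between functions, each of which is bilinear.\<close>
  have "cyclic_twist p1 p2 p4 g h =
    (let i = idx g; j = idx h in
      if i = 0 \<or> j = 0 \<or> i = j then (\<lambda>r s. 0)
      else if j = cyc i 1 then p1
      else if j = cyc i 2 then p2
      else if j = cyc i 4 then p4
      else if j = cyc i 3 then (\<lambda>r s. - p4 s r)
      else if j = cyc i 5 then (\<lambda>r s. - p2 s r)
      else (\<lambda>r s. - p1 s r))" for g h
    by (simp add: fun_eq_iff cyclic_twist_def Let_def)
  then show ?thesis
    unfolding is_twist_def Let_def using assms(3-5) swap zero by simp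
qed

lemma cyclic_twist_diagonal: "cyclic_twist p1 p2 p4 g g r s = 0"
  by (simp add: cyclic_twist_def)

text \<open>The index differences 6, 5, 3 are the negatives of 1, 2, 4 modulo 7, and the maps at the
  former are defined as the negated transposes of those at the latter.\<close>

lemma cyclic_twist_antisymmetric: "cyclic_twist p1 p2 p4 g h r s = - cyclic_twist p1 p2 p4 h g s r"
proof -
  have "\<forall>g h. cyclic_twist p1 p2 p4 g h r s = - cyclic_twist p1 p2 p4 h g s r"
    unfolding forall_Z2_3 by (simp add: cyclic_twist_def idx_simps cyc_def)
  then show ?thesis by blast
qed

text \<open>The automorphism of \<open>G\<close> that maps \<open>g\<^sub>i\<close> to \<open>g\<^sub>i\<^sub>+\<^sub>1\<close>.\<close>

definition shift :: "Z2_3 \<Rightarrow> Z2_3" where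
  "shift = (\<lambda>(a, b, c). (c, a + c, b))"

lemma shift_add: "shift (g + h) = shift g + shift h"
  by (cases g; cases h) (simp add: shift_def algebra_simps del: add_bit_eq_xor)

lemma surj_shift: "\<exists>g. h = shift g"
proof (cases h)
  case (fields a b c)
  \<comment> \<open>The preimage comes from solving the linear system \<open>c' = a\<close>,
    \<open>a' + c' = b\<close>, \<open>b' = c\<close>.\<close>
  then have "h = shift (b - a, c, a)"
    by (simp add: shift_def del: add_bit_eq_xor)
  then show ?thesis ..
qed

text \<open>\<open>shift\<close> fixes the index 0 and adds 1 modulo 7 to all others, which
  preserves index differences.\<close>

lemma cyclic_twist_shift: "cyclic_twist p1 p2 p4 (shift g) (shift h) = cyclic_twist p1 p2 p4 g h"
proof -
  have "\<forall>g h. cyclic_twist p1 p2 p4 (shift g) (shift h) = cyclic_twist p1 p2 p4 g h"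
    unfolding forall_Z2_3 by (simp add: cyclic_twist_def idx_simps cyc_def shift_def fun_eq_iff)
  then show ?thesis by blast
qed

text \<open>The six \<open>swap\<close> identities are the Jacobi identity for triples in which one
  nonzero element is repeated and the third is a different nonzero element. The four
  \<open>jacobi\<close> identities correspond to the four orbits of \<open>shift\<close> on the 28
  sets of three linearly independent elements. For three distinct elements with sum 0 every term
  contains some \<open>\<sigma> g g\<close> and vanishes.\<close>

lemma cyclic_twist_jacobi:
  assumes add: "\<And>p x y z. p \<in> {p1, p2, p4} \<Longrightarrow> p (x + y) z = p x z + p y z"
      "\<And>p x y z. p \<in> {p1, p2, p4} \<Longrightarrow> p x (y + z) = p x y + p x z"
    and swap: "\<And>r s t. p4 (p1 r t) s = p4 (p1 s t) r"
      "\<And>r s t. p1 (p2 r t) s = p1 (p2 s t) r"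
      "\<And>r s t. p2 (p4 r t) s = p2 (p4 s t) r"
      "\<And>r s t. p1 s (p4 t r) = p1 r (p4 t s)"
      "\<And>r s t. p2 s (p1 t r) = p2 r (p1 t s)"
      "\<And>r s t. p4 s (p2 t r) = p4 r (p2 t s)"
    and jacobi: "\<And>r s t. p1 (p1 r t) s = - p2 r (p4 s t) - p4 t (p4 r s)"
      "\<And>r s t. p2 (p2 r t) s = - p4 r (p1 s t) - p1 t (p1 r s)"
      "\<And>r s t. p4 (p4 r t) s = - p1 r (p2 s t) - p2 t (p2 r s)"
      "\<And>r s t. p1 (p4 s r) t = - p2 (p1 t s) r - p4 (p2 r t) s"
  defines "\<sigma> \<equiv> cyclic_twist p1 p2 p4"
  shows "\<sigma> g (h + k) r (\<sigma> h k s t) + \<sigma> h (k + g) s (\<sigma> k g t r) + \<sigma> k (g + h) t (\<sigma> g h r s) = 0"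
proof -
  have additive: "Modules.additive (p x)" "Modules.additive (\<lambda>x. p x y)" if "p \<in> {p1, p2, p4}" for p x y
    using add[OF that] by (simp_all add: Modules.additive_def)
  have zero: "p x 0 = 0" "p 0 x = 0" if "p \<in> {p1, p2, p4}" for p x
    using additive[OF that] Modules.additive.zero by blast+
  have minus: "p x (- y) = - p x y" "p (- x) y = - p x y" if "p \<in> {p1, p2, p4}" for p x y
    using additive[OF that] Modules.additive.minus by blast+
  define J where "J g h k \<longleftrightarrow>
    \<sigma> g (h + k) r (\<sigma> h k s t) + \<sigma> h (k + g) s (\<sigma> k g t r) + \<sigma> k (g + h) t (\<sigma> g h r s) = 0" for g h k
  have "\<forall>h k. J (0,0,0) h k"
    unfolding forall_Z2_3 J_def \<sigma>_def
    by (simp add: cyclic_twist_def idx_simps cyc_def zero)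
  have gl1: "\<forall>h k. J (1,0,0) h k"
    unfolding forall_Z2_3 J_def \<sigma>_def
    by (simp add: cyclic_twist_def idx_simps cyc_def zero minus swap jacobi)
  have shift: "\<forall>h k. J (shift g) h k" if "\<forall>h k. J g h k" for g
  proof (intro allI)
    fix h k
    obtain h' k' where "h = shift h'" "k = shift k'"
      using surj_shift by metis
    moreover have "J g h' k'"
      using that by blast
    ultimately show "J (shift g) h k"
      unfolding J_def \<sigma>_def by (simp add: cyclic_twist_shift flip: shift_add)
  qed
  \<comment> \<open>The first six iterates of \<open>shift\<close> carry \<open>g\<^sub>1\<close> to
    \<open>g\<^sub>2\<close>, ..., \<open>g\<^sub>7\<close>; together with the neutral element this
    exhausts the group.\<close>
  have "\<forall>h k. J ((shift ^^ n) (1,0,0)) h k" for n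
    by (induction n) (simp_all add: gl1 shift)
  from this[of 1] this[of 2] this[of 3] this[of 4] this[of 5] this[of 6]
  have "\<forall>g. \<forall>h k. J g h k"
    unfolding forall_Z2_3[of "\<lambda>g. \<forall>h k. J g h k"]
    using gl1 \<open>\<forall>h k. J (0,0,0) h k\<close> by (simp add: shift_def eval_nat_numeral)
  then show ?thesis
    unfolding J_def by blast
qed

section \<open>The Jacobi identity for the two concrete twists\<close>

lemma vector_4:
  "(vector [w, x, y, z] :: 'a::zero ^ 4) $ 1 = w"
  "(vector [w, x, y, z] :: 'a ^ 4) $ 2 = x"
  "(vector [w, x, y, z] :: 'a ^ 4) $ 3 = y"
  "(vector [w, x, y, z] :: 'a ^ 4) $ 4 = z"
  unfolding vector_def by auto

text \<open>In each coordinate the ten required identities are polynomial identities with integer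
  coefficients, hence valid over every field.\<close>

lemma sigma4_jacobi:
  "sigma4 g (h + k) r (sigma4 h k s t) + sigma4 h (k + g) s (sigma4 k g t r) +
    sigma4 k (g + h) t (sigma4 g h r s) = 0"
  unfolding sigma4_def
  by (rule cyclic_twist_jacobi)
    (auto simp: vec_eq_iff forall_4 vector_4 algebra_simps)

lemma sigma3_jacobi:
  "sigma3 g (h + k) r (sigma3 h k s t) + sigma3 h (k + g) s (sigma3 k g t r) +
    sigma3 k (g + h) t (sigma3 g h r s) = 0"
  unfolding sigma3_def
  by (rule cyclic_twist_jacobi)
    (auto simp: vec_eq_iff forall_3 algebra_simps)

section \<open>Cyclic invariance of the scalar maps\<close>

definition idx_add :: "nat \<Rightarrow> nat \<Rightarrow> nat" where
  "idx_add i j = idx (gl i + gl j)"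

text \<open>The table encodes the lines \<open>{i, i+1, i+3}\<close> of the Fano plane, with indices
  modulo 7: two distinct points add up to the third point on their line.\<close>

lemma idx_add_simps:
  "idx_add 1 2 = 4" "idx_add 1 3 = 7" "idx_add 1 4 = 2" "idx_add 1 5 = 6" "idx_add 1 6 = 5" "idx_add 1 7 = 3"
  "idx_add 2 1 = 4" "idx_add 2 3 = 5" "idx_add 2 4 = 1" "idx_add 2 5 = 3" "idx_add 2 6 = 7" "idx_add 2 7 = 6"
  "idx_add 3 1 = 7" "idx_add 3 2 = 5" "idx_add 3 4 = 6" "idx_add 3 5 = 2" "idx_add 3 6 = 4" "idx_add 3 7 = 1"
  "idx_add 4 1 = 2" "idx_add 4 2 = 1" "idx_add 4 3 = 6" "idx_add 4 5 = 7" "idx_add 4 6 = 3" "idx_add 4 7 = 5"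
  "idx_add 5 1 = 6" "idx_add 5 2 = 3" "idx_add 5 3 = 2" "idx_add 5 4 = 7" "idx_add 5 6 = 1" "idx_add 5 7 = 4"
  "idx_add 6 1 = 5" "idx_add 6 2 = 7" "idx_add 6 3 = 4" "idx_add 6 4 = 3" "idx_add 6 5 = 1" "idx_add 6 7 = 2"
  "idx_add 7 1 = 3" "idx_add 7 2 = 6" "idx_add 7 3 = 1" "idx_add 7 4 = 5" "idx_add 7 5 = 4" "idx_add 7 6 = 2"
  by (simp_all add: idx_add_def gl_def idx_simps)

lemma gl_idx: "gl (idx g) = g"
  unfolding idx_def using bij_betw_gl
  by (intro f_the_inv_into_f) (auto simp: bij_betw_def)

lemma idx_plus: "idx (g + h) = idx_add (idx g) (idx h)"
  by (simp add: idx_add_def gl_idx)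

text \<open>The product \<open>\<epsilon>\<^sub>i\<^sub>,\<^sub>j\<^sub>+\<^sub>k \<epsilon>\<^sub>j\<^sub>,\<^sub>k\<close> of values of \<open>\<epsilon>\<^sup>T\<close> has to be invariant under
  cyclic permutations; \<open>i \<noteq> j + k\<close> excludes collinear triples, where it vanishes.\<close>

definition nice :: "nat set set \<Rightarrow> bool" where
  "nice T \<longleftrightarrow> (\<forall>i\<in>{1..7}. \<forall>j\<in>{1..7}. \<forall>k\<in>{1..7}.
     i \<noteq> j \<and> j \<noteq> k \<and> k \<noteq> i \<and> i \<noteq> idx_add j k \<and> {j, k} \<in> T \<and> {i, idx_add j k} \<in> T \<longrightarrow>
     {k, i} \<in> T \<and> {j, idx_add k i} \<in> T)"

lemma atLeastAtMost_1_7: "{1..7::nat} = {1, 2, 3, 4, 5, 6, 7}"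
  by auto

text \<open>A criterion symmetric in \<open>i\<close> and \<open>j\<close>, used to evaluate
  membership in the last two sets of the list, which are given through
  \<open>pairs_X\<close>.\<close>

lemma doubleton_mem_pairs_X: "{i, j} \<in> pairs_X \<longleftrightarrow> i \<in> {1..7} \<and> j \<in> {1..7} \<and> i \<noteq> j"
proof -
  have "{i, j} \<in> pairs_X" if "i \<in> {1..7}" "j \<in> {1..7}" "i < j" for i j
    using that by (auto simp: pairs_X_def)
  from this[of i j] this[of j i]
  have "{i, j} \<in> pairs_X" if "i \<in> {1..7}" "j \<in> {1..7}" "i \<noteq> j"
    using that by (metis insert_commute linorder_neqE_nat)
  then show ?thesis
    by (auto simp: pairs_X_def doubleton_eq_iff)
qed

lemma nice_T_set:
  assumes "i \<in> {1..24}"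
  shows "nice (T_set i)"
proof -
  \<comment> \<open>List positions start at 0, hence \<open>i - 1\<close>. Passing to
    \<open>list_all\<close> leaves a finite check for each of the 24 sets.\<close>
  have *: "nice (xs ! (i - 1))" if "list_all nice xs" "length xs = 24" for xs
    using that assms by (auto simp: list_all_length)
  show ?thesis
    unfolding T_set_def
    by (rule *) (simp_all add: nice_def atLeastAtMost_1_7 T19_def doubleton_mem_pairs_X idx_add_simps
        doubleton_eq_iff del: One_nat_def)
qed

lemma gl_0: "gl 0 = 0"
  by (simp add: gl_def zero_prod_def)

lemma idx_eq_iff: "idx g = idx h \<longleftrightarrow> g = h"
  by (metis gl_idx)

lemma idx_mem: "g \<noteq> 0 \<Longrightarrow> idx g \<in> {1..7}"
proof -
  have "\<forall>g. g \<noteq> 0 \<longrightarrow> idx g \<in> {1..7}"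
    unfolding forall_Z2_3 by (simp add: idx_simps zero_prod_def)
  then show "g \<noteq> 0 \<Longrightarrow> idx g \<in> {1..7}" by blast
qed

lemma Z2_3_add_eq_iff: "g + h = k \<longleftrightarrow> g = k + (h :: Z2_3)"
proof -
  have "h + h = 0"
    by (cases h) (simp add: zero_prod_def)
  then have "(k + h) + h = k" for k
    by (simp only: add.assoc add.right_neutral)
  then show ?thesis
    by auto
qed

lemma sym_map_commute: "sym_map c g h = sym_map c h g"
  by (simp add: sym_map_def insert_commute)

lemma eps_commute: "eps T g h = eps T h g"
  by (simp add: eps_def sym_map_commute)

lemma eps_eq:
  "eps T g h = (if g \<noteq> h \<and> g \<noteq> 0 \<and> h \<noteq> 0 \<and> {idx g, idx h} \<in> T then 1 else 0)"
  by (auto simp: eps_def sym_map_def gl_0)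

text \<open>Both products are 0 or 1, so it suffices to compare when they equal 1.
  \<open>nice\<close> provides only the implication from \<open>(g, h, k)\<close> to
  \<open>(h, k, g)\<close>.\<close>

lemma eps_cyclic:
  assumes "nice T" "g \<noteq> h" "h \<noteq> k" "k \<noteq> g"
  shows "eps T g (h + k) * eps T h k = eps T h (k + g) * eps T k g"
proof -
  define P where "P g h k \<longleftrightarrow> eps T g (h + k) * eps T h k = (1::'a)" for g h k
  have step: "P h k g" if "P g h k" "g \<noteq> h" "h \<noteq> k" "k \<noteq> g" for g h k
  proof -
    have *: "g \<noteq> 0" "h \<noteq> 0" "k \<noteq> 0" "g \<noteq> h + k" "{idx h, idx k} \<in> T" "{idx g, idx (h + k)} \<in> T"
      using that(1) by (auto simp: P_def eps_eq split: if_splits)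
    have **: "{idx k, idx g} \<in> T \<and> {idx h, idx (k + g)} \<in> T"
    proof -
      have "idx g \<in> {1..7}" "idx h \<in> {1..7}" "idx k \<in> {1..7}" "idx g \<noteq> idx h" "idx h \<noteq> idx k"
        "idx k \<noteq> idx g" "idx g \<noteq> idx_add (idx h) (idx k)"
        using *(1-4) that(2-4) idx_mem by (simp_all add: idx_eq_iff flip: idx_plus)
      then show ?thesis
        using assms(1) *(5,6) unfolding nice_def idx_plus by blast
    qed
    \<comment> \<open>Every element is its own inverse, so these follow from
      \<open>g \<noteq> h + k\<close> and \<open>k \<noteq> g\<close>.\<close>
    have "h \<noteq> k + g" "k + g \<noteq> 0"
      using *(4) that(4) by (auto simp: Z2_3_add_eq_iff add.commute)
    then show ?thesis
      using * ** that by (simp add: P_def eps_eq)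
  qed
  \<comment> \<open>Two further rotations lead from \<open>(h, k, g)\<close> back to
    \<open>(g, h, k)\<close>, so the implication is an equivalence.\<close>
  have "P g h k \<longleftrightarrow> P h k g"
    using step assms(2-4) by metis
  moreover have "eps T g (h + k) * eps T h k \<in> {0, 1::'a}" for g h k
    by (simp add: eps_eq)
  ultimately show ?thesis
    unfolding P_def by (metis insertE singletonD)
qed

text \<open>Both sides are 0. If a product were nonzero, \<open>g\<^sub>1\<close> would lie in both
  \<open>{g, h + k}\<close> and \<open>{h, k}\<close>; by distinctness \<open>h + k\<close> would be
  \<open>h\<close> or \<open>k\<close>, making one of these neutral, where \<open>sym_map\<close>
  vanishes.\<close>

lemma star_cyclic:
  fixes c :: "nat set \<Rightarrow> 'f::field"
  assumes star: "\<And>p. c p \<noteq> 0 \<Longrightarrow> 1 \<in> p" and "g \<noteq> h" "h \<noteq> k" "k \<noteq> g"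
  shows "sym_map c g (h + k) * sym_map c h k = sym_map c h (k + g) * sym_map c k g"
proof -
  have zero: "sym_map c g (h + k) * sym_map c h k = 0" if "g \<noteq> h" "h \<noteq> k" "k \<noteq> g" for g h k
  proof (rule ccontr)
    assume "\<not> ?thesis"
    then have *: "g \<noteq> 0" "h \<noteq> 0" "k \<noteq> 0" "1 \<in> {idx g, idx (h + k)}" "1 \<in> {idx h, idx k}"
      using star by (auto simp: sym_map_def gl_0 split: if_splits)
    have "idx g = 1 \<or> idx (h + k) = 1" "idx h = 1 \<or> idx k = 1"
      using *(4,5) by auto
    then have "g = h \<or> g = k \<or> h + k = h \<or> h + k = k"
      by (metis idx_eq_iff)
    then show False
      using * that by auto
  qed
  show ?thesis
    using zero assms(2-4) by metis
qed

section \<open>The listed twists on the three carriers\<close>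

lemma lie_algebra_over_group_twist_list:
  assumes "alternating_jacobi_twist smul V \<sigma>" and "\<tau> \<in> twist_list smul \<sigma>"
  shows "lie_algebra_over_group smul V \<tau>"
proof -
  interpret alternating_jacobi_twist smul V \<sigma>
    by fact
  have star: "lie_algebra_over_group smul V (scale_twist smul (sym_map c) \<sigma>)"
    if "\<And>p. c p \<noteq> 0 \<Longrightarrow> 1 \<in> p" for c
    by (rule lie_algebra_over_group_scale_twist) (rule sym_map_commute, rule star_cyclic[OF that])
  consider (eps) i where "i \<in> {1..24}" "\<tau> = scale_twist smul (eps (T_set i)) \<sigma>"
    | (eta) l where "\<tau> = scale_twist smul (eta l) \<sigma>"
    | (mu) l where "\<tau> = scale_twist smul (mu l) \<sigma>"
    | (beta) l1 l2 where "\<tau> = scale_twist smul (beta l1 l2) \<sigma>"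
    using assms(2) unfolding twist_list_def by blast
  then show ?thesis
  proof cases
    case eps
    show ?thesis
      unfolding eps(2)
      by (rule lie_algebra_over_group_scale_twist)
        (rule eps_commute, rule eps_cyclic[OF nice_T_set[OF eps(1)]])
  next
    case eta
    show ?thesis
      unfolding eta eta_def by (rule star) (auto split: if_splits)
  next
    case mu
    show ?thesis
      unfolding mu mu_def by (rule star) (auto split: if_splits)
  next
    case beta
    show ?thesis
      unfolding beta beta_def by (rule star) (auto split: if_splits)
  qed
qed

lemma alternating_jacobi_twist_sigma4:
  "alternating_jacobi_twist (*s) UNIV (sigma4 :: _ \<Rightarrow> _ \<Rightarrow> 'f::field ^ 4 \<Rightarrow> _)"
proof unfold_locales
  show "is_twist (*s) UNIV (sigma4 :: _ \<Rightarrow> _ \<Rightarrow> 'f ^ 4 \<Rightarrow> _)"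
    unfolding sigma4_def
    by (intro is_twist_cyclic_twist vec.subspace_UNIV vec.vector_space_axioms)
      (auto simp: bilinear_on_def vec_eq_iff forall_4 vector_4 algebra_simps)
  show "sigma4 g h r s = - sigma4 h g s r" for g h and r s :: "'f ^ 4"
    unfolding sigma4_def by (rule cyclic_twist_antisymmetric)
qed (simp_all add: sigma4_jacobi, simp add: sigma4_def cyclic_twist_diagonal)

text \<open>Solving for the third coordinate turns membership into a substitution, after which
  closure properties are identities in the first two coordinates.\<close>

lemma mem_S_subspace_iff: "a \<in> S_subspace \<longleftrightarrow> a$3 = - a$1 - a$2"
  unfolding S_subspace_def by (simp add: eq_diff_eq eq_neg_iff_add_eq_0 ac_simps)

lemma subspace_S: "vec.subspace S_subspace"
  by (auto simp: vec.subspace_def mem_S_subspace_iff, simp_all add: algebra_simps)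

lemma is_twist_sigma3_UNIV: "is_twist (*s) UNIV (sigma3 :: _ \<Rightarrow> _ \<Rightarrow> 'f::field ^ 3 \<Rightarrow> _)"
  unfolding sigma3_def
  by (intro is_twist_cyclic_twist vec.subspace_UNIV vec.vector_space_axioms)
    (auto simp: bilinear_on_def vec_eq_iff forall_3 algebra_simps)

text \<open>The coordinate sum of the first map is \<open>a1 b2 - (a2 + a3) (b1 + b3)\<close>, which
  is 0 when both coordinate sums are. The other two maps give
  \<open>a2 b3 - (a1 + a3) (b1 + b2)\<close> and \<open>a3 b1 - (a1 + a2) (b2 + b3)\<close>.\<close>

lemma is_twist_sigma3_S: "is_twist (*s) S_subspace (sigma3 :: _ \<Rightarrow> _ \<Rightarrow> 'f::field ^ 3 \<Rightarrow> _)"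
  unfolding sigma3_def
  by (intro is_twist_cyclic_twist subspace_S vec.vector_space_axioms)
    (auto simp: mem_S_subspace_iff bilinear_on_def vec_eq_iff forall_3, simp_all add: algebra_simps)

text \<open>The identities hold for all vectors of the ambient space and are inherited by every
  subspace that is closed under the twist.\<close>

lemma alternating_jacobi_twist_sigma3:
  assumes "vec.subspace V" "is_twist (*s) V sigma3"
  shows "alternating_jacobi_twist (*s) V (sigma3 :: _ \<Rightarrow> _ \<Rightarrow> 'f::field ^ 3 \<Rightarrow> _)"
proof unfold_locales
  show "sigma3 g h r s = - sigma3 h g s r" for g h and r s :: "'f ^ 3"
    unfolding sigma3_def by (rule cyclic_twist_antisymmetric)
qed (simp_all add: assms sigma3_jacobi, simp add: sigma3_def cyclic_twist_diagonal)

theorem corollary3p9: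
  shows "(\<forall>\<tau> \<in> twist_list (*s) (sigma4 :: Z2_3 \<Rightarrow> Z2_3 \<Rightarrow> 'f::field ^ 4 \<Rightarrow> 'f ^ 4 \<Rightarrow> 'f ^ 4).
           lie_algebra_over_group (*s) UNIV \<tau>) \<and>
         (\<forall>\<tau> \<in> twist_list (*s) (sigma3 :: Z2_3 \<Rightarrow> Z2_3 \<Rightarrow> 'f ^ 3 \<Rightarrow> 'f ^ 3 \<Rightarrow> 'f ^ 3).
           lie_algebra_over_group (*s) UNIV \<tau>) \<and>
         (\<forall>\<tau> \<in> twist_list (*s) (sigma3 :: Z2_3 \<Rightarrow> Z2_3 \<Rightarrow> 'f ^ 3 \<Rightarrow> 'f ^ 3 \<Rightarrow> 'f ^ 3).
           lie_algebra_over_group (*s) S_subspace \<tau>)"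
  by (intro conjI ballI; erule lie_algebra_over_group_twist_list[rotated])
    (rule alternating_jacobi_twist_sigma4
      alternating_jacobi_twist_sigma3[OF vec.subspace_UNIV is_twist_sigma3_UNIV]
      alternating_jacobi_twist_sigma3[OF subspace_S is_twist_sigma3_S])+

end
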